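(* Let $\phi : X \to \mathbb{C}$ be a Koopman eigenfunction of $\dot{x} = f(x)$ with eigenvalue $\lambda \in \mathbb{C}$, and for a real number $c$ let $M(c) = \{x \in X : |\phi(x)| \le c\}$. If $M(c)$ is closed and $\mathrm{Re}(\lambda) \le 0$, then any trajectory that enters $M(c)$ remains in $M(c)$; that is, if $x(t_1) \in M(c)$ for a trajectory $x(t)$ of the system, then $x(t_2) \in M(c)$ for all $t_2 \ge t_1$.
   Context: Consider $\dot{x} = f(x)$, $x \in X \subset \mathbb{R}^d$, with $f : \mathbb{R}^d \to \mathbb{R}^d$ sufficiently smooth to guarantee existence and uniqueness of solutions. $F^t(x_0)$ denotes the flow, i.e. the solution at time $t$ starting from $x_0$ at time $0$. $X$ is compact and forward invariant under $F^t$. The Koopman operator acts on observables $g : X \to \mathbb{C}$ by $\mathcal{K}^t g = g \circ F^t$. A function $\phi : X \to \mathbb{C}$ is a (Koopman) eigenfunction with eigenvalue $\lambda \in \mathbb{C}$ if $\mathcal{K}^t\phi = e^{\lambda t}\phi$ for all $t$, i.e. $\phi(F^t(x)) = e^{\lambda t}\phi(x)$. Eigenfunctions are not assumed continuous or bounded unless stated. *)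

theory Defs
  imports "HOL-Analysis.Analysis"
begin

definition is_solution :: "('a::real_normed_vector \<Rightarrow> 'a) \<Rightarrow> real set \<Rightarrow> (real \<Rightarrow> 'a) \<Rightarrow> bool" where
  "is_solution f I x \<longleftrightarrow> (\<forall>t\<in>I. (x has_vector_derivative f (x t)) (at t within I))"

(* The regularity "f is smooth enough for existence and uniqueness" is expressed by its
   consequence, local existence and uniqueness forward in time, rather than by one particular
   sufficient condition such as a Lipschitz bound. *)
definition well_posed :: "('a::real_normed_vector \<Rightarrow> 'a) \<Rightarrow> bool" where
  "well_posed f \<longleftrightarrow>
     (\<forall>x0. \<exists>T>0. \<exists>x. is_solution f {0..T} x \<and> x 0 = x0) \<and>
     (\<forall>T x y. is_solution f {0..T} x \<longrightarrow> is_solution f {0..T} y \<longrightarrow> x 0 = y 0 \<longrightarrow>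
        (\<forall>t\<in>{0..T}. x t = y t))"

definition flow_defined :: "('a::real_normed_vector \<Rightarrow> 'a) \<Rightarrow> real \<Rightarrow> 'a \<Rightarrow> bool" where
  "flow_defined f t x0 \<longleftrightarrow> (\<exists>x. is_solution f {0..t} x \<and> x 0 = x0)"

(* Only meaningful for t >= 0 and where flow_defined f t x0 holds. *)
definition flow :: "('a::real_normed_vector \<Rightarrow> 'a) \<Rightarrow> real \<Rightarrow> 'a \<Rightarrow> 'a" where
  "flow f t x0 = (THE y. \<exists>x. is_solution f {0..t} x \<and> x 0 = x0 \<and> x t = y)"

(* Invariance includes that the flow exists for all times t >= 0 on X: otherwise membership of
   flow f t x0 in X would say nothing. *)
definition forward_invariant :: "('a::real_normed_vector \<Rightarrow> 'a) \<Rightarrow> 'a set \<Rightarrow> bool" where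
  "forward_invariant f X \<longleftrightarrow> (\<forall>x0\<in>X. \<forall>t\<ge>0. flow_defined f t x0 \<and> flow f t x0 \<in> X)"

definition koopman ::
  "('a::real_normed_vector \<Rightarrow> 'a) \<Rightarrow> real \<Rightarrow> ('a \<Rightarrow> complex) \<Rightarrow> 'a \<Rightarrow> complex" where
  "koopman f t g = g \<circ> flow f t"

(* Observables on X are total functions of which only the values on X matter. *)
definition koopman_eigenfunction ::
  "('a::real_normed_vector \<Rightarrow> 'a) \<Rightarrow> 'a set \<Rightarrow> complex \<Rightarrow> ('a \<Rightarrow> complex) \<Rightarrow> bool" where
  "koopman_eigenfunction f X l \<phi> \<longleftrightarrow>
     (\<forall>t\<ge>0. \<forall>x\<in>X. koopman f t \<phi> x = exp (l * complex_of_real t) * \<phi> x)"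

definition sublevel :: "'a set \<Rightarrow> ('a \<Rightarrow> complex) \<Rightarrow> real \<Rightarrow> 'a set" where
  "sublevel X \<phi> c = {x \<in> X. cmod (\<phi> x) \<le> c}"

end

theory Submission
  imports Defs
begin

text \<open>The trajectory between \<open>t1\<close> and \<open>t2\<close> is, after shifting time, the solution on
  \<open>{0..t2 - t1}\<close> issuing from \<open>x t1\<close>; by uniqueness \<open>x t2\<close> is therefore the image of \<open>x t1\<close>
  under the flow for time \<open>t2 - t1\<close> (\<open>flow_along_solution\<close>). Forward invariance keeps this
  image in \<open>X\<close>, and the eigenfunction equation multiplies \<open>cmod \<phi>\<close> by \<open>exp (Re l * (t2 - t1))\<close>,
  which is at most \<open>1\<close>.\<close>

lemma is_solution_subset:
  assumes "is_solution f I x" and "J \<subseteq> I"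
  shows "is_solution f J x"
  using assms unfolding is_solution_def
  by (blast intro: has_vector_derivative_within_subset)

lemma is_solution_shift:
  assumes "is_solution f ((\<lambda>s. a + s) ` J) x"
  shows "is_solution f J (\<lambda>s. x (a + s))"
  unfolding is_solution_def
proof
  fix s assume "s \<in> J"
  then have "(x has_vector_derivative f (x (a + s))) (at (a + s) within (\<lambda>s. a + s) ` J)"
    using assms unfolding is_solution_def by blast
  moreover have "((\<lambda>s. a + s) has_vector_derivative 1) (at s within J)"
    using has_vector_derivative_add[OF has_vector_derivative_const has_vector_derivative_id]
    by simp
  ultimately show "((\<lambda>s. x (a + s)) has_vector_derivative f (x (a + s))) (at s within J)"
    using vector_diff_chain_within[of "\<lambda>s. a + s" 1 s J x] by (simp add: o_def)
qed

text \<open>Uniqueness of solutions is what makes the definite description in \<open>flow\<close> denote.\<close>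

lemma flow_eqI:
  assumes "well_posed f" and "0 \<le> t" and "is_solution f {0..t} y"
  shows "flow f t (y 0) = y t"
  unfolding flow_def
proof (rule the_equality)
  show "\<exists>x. is_solution f {0..t} x \<and> x 0 = y 0 \<and> x t = y t"
    using assms(3) by blast
next
  fix z assume "\<exists>x. is_solution f {0..t} x \<and> x 0 = y 0 \<and> x t = z"
  then obtain x where "is_solution f {0..t} x" "x 0 = y 0" "x t = z" by blast
  moreover have "t \<in> {0..t}" using assms(2) by simp
  ultimately show "z = y t"
    using assms(1,3) unfolding well_posed_def by metis
qed

lemma flow_along_solution:
  assumes "well_posed f" and "is_interval I" and "is_solution f I x"
    and "t1 \<in> I" and "t2 \<in> I" and "t1 \<le> t2"
  shows "flow f (t2 - t1) (x t1) = x t2"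
proof -
  have "(\<lambda>s. t1 + s) ` {0..t2 - t1} \<subseteq> I"
    using mem_is_interval_1_I[OF assms(2,4,5)] by auto
  then have "is_solution f {0..t2 - t1} (\<lambda>s. x (t1 + s))"
    by (rule is_solution_shift[OF is_solution_subset[OF assms(3)]])
  from flow_eqI[OF assms(1) _ this] show ?thesis
    using assms(6) by simp
qed

lemma cmod_eigenfunction_flow_le:
  assumes "koopman_eigenfunction f X l \<phi>" and "Re l \<le> 0" and "0 \<le> t" and "p \<in> X"
  shows "cmod (\<phi> (flow f t p)) \<le> cmod (\<phi> p)"
proof -
  have "\<phi> (flow f t p) = exp (l * complex_of_real t) * \<phi> p"
    using assms unfolding koopman_eigenfunction_def koopman_def by simp
  then have "cmod (\<phi> (flow f t p)) = exp (Re l * t) * cmod (\<phi> p)"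
    by (simp add: norm_mult)
  also have "\<dots> \<le> cmod (\<phi> p)"
    using assms(2,3) by (intro mult_left_le_one_le) (auto simp: mult_nonpos_nonneg)
  finally show ?thesis .
qed

theorem mainTheorem3:
  fixes f :: "real ^ 'd \<Rightarrow> real ^ 'd"
    and X :: "(real ^ 'd) set"
    and \<phi> :: "real ^ 'd \<Rightarrow> complex"
    and l :: complex
    and c t1 t2 :: real
    and x :: "real \<Rightarrow> real ^ 'd"
    and I :: "real set"
  assumes "well_posed f"
    and "compact X"
    and "forward_invariant f X"
    and "koopman_eigenfunction f X l \<phi>"
    and "closed (sublevel X \<phi> c)"
    and "Re l \<le> 0"
    and "is_interval I"
    and "is_solution f I x"
    and "t1 \<in> I" and "t2 \<in> I" and "t1 \<le> t2"
    and "x t1 \<in> sublevel X \<phi> c"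
  shows "x t2 \<in> sublevel X \<phi> c"
proof -
  have "x t1 \<in> X" and le: "cmod (\<phi> (x t1)) \<le> c"
    using assms(12) by (auto simp: sublevel_def)
  have t: "0 \<le> t2 - t1" using assms(11) by simp
  have flow: "flow f (t2 - t1) (x t1) = x t2"
    by (rule flow_along_solution[OF assms(1,7-11)])
  have "x t2 \<in> X"
    using assms(3) \<open>x t1 \<in> X\<close> t flow unfolding forward_invariant_def by metis
  moreover have "cmod (\<phi> (x t2)) \<le> c"
    using cmod_eigenfunction_flow_le[OF assms(4,6) t \<open>x t1 \<in> X\<close>] le by (simp add: flow)
  ultimately show ?thesis by (simp add: sublevel_def)
qed

end
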